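(* The following evaluations hold: $$h'_{2,1/4}=2^{-1/4}\sqrt[4]{\sqrt 2-1},$$ $$h'_{2,3/4}=2^{-1}\sqrt[4]{(16-8\sqrt3)(\sqrt3+\sqrt2)},$$ $$h'_{2,1/12}=2^{-1}\sqrt[4]{(16-8\sqrt3)(\sqrt3-\sqrt2)},$$ $$h'_{2,9/4}=2^{-1}\sqrt[4]{(\sqrt2-1)^3(56+32\sqrt3)},$$ $$h'_{2,1/36}=2^{-1}\sqrt[4]{(\sqrt2-1)^3(56-32\sqrt3)}.$$
   Context: For $|q|<1$, $\varphi(q)=\sum_{m=-\infty}^{\infty}q^{m^2}$. For positive real $k,n$ define $$h'_{k,n}=\frac{\varphi(-q)}{k^{1/4}\varphi(-q^k)},\qquad q=e^{-2\pi\sqrt{n/k}}.$$ *)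

theory Defs
  imports "HOL-Analysis.Analysis"
begin

text \<open>
  Ramanujan's theta function. It is meant for \<open>norm q < 1\<close>, where the bilateral
  series converges absolutely (see \<open>ramanujan_phi_abs_summable\<close>); the type class
  covers real and complex \<open>q\<close>.
\<close>

definition ramanujan_phi :: "'a :: real_normed_field \<Rightarrow> 'a" where
  "ramanujan_phi q = (\<Sum>\<^sub>\<infinity>m::int. q powi (m\<^sup>2))"

text \<open>The arguments are meant to be positive.\<close>

definition h' :: "real \<Rightarrow> real \<Rightarrow> real" where
  "h' k n = (let q = exp (- 2 * pi * sqrt (n / k))
             in ramanujan_phi (- q) / (k powr (1/4) * ramanujan_phi (- (q powr k))))"

lemma ramanujan_phi_abs_summable:
  fixes q :: "'a :: real_normed_field"
  assumes q: "norm q < 1"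
  shows "(\<lambda>m::int. norm (q powi (m\<^sup>2))) summable_on UNIV"
proof -
  have le: "norm (q powi ((int n)\<^sup>2)) \<le> norm q ^ n" for n :: nat
  proof -
    have "q powi ((int n)\<^sup>2) = q ^ (n\<^sup>2)"
      by (metis of_nat_power power_int_of_nat)
    moreover have "norm q ^ (n\<^sup>2) \<le> norm q ^ n"
      using q by (intro power_decreasing) (auto simp: power2_eq_square)
    ultimately show ?thesis
      by (simp add: norm_power)
  qed
  have "(\<lambda>n. norm q ^ n) summable_on (UNIV :: nat set)"
    using q by (intro norm_summable_imp_summable_on) (simp add: norm_power summable_geometric)
  then have nat: "(\<lambda>n::nat. norm (q powi ((int n)\<^sup>2))) summable_on UNIV"
    by (rule summable_on_comparison_test) (use le in simp_all)
  have pos: "(\<lambda>m::int. norm (q powi (m\<^sup>2))) summable_on range int"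
    using nat summable_on_reindex[of int UNIV "\<lambda>m. norm (q powi (m\<^sup>2))"]
    by (simp add: o_def)
  have neg: "(\<lambda>m::int. norm (q powi (m\<^sup>2))) summable_on range (\<lambda>n. - int n)"
    using nat summable_on_reindex[of "\<lambda>n. - int n" UNIV "\<lambda>m. norm (q powi (m\<^sup>2))"]
    by (simp add: o_def inj_on_def)
  have "(UNIV :: int set) = range int \<union> range (\<lambda>n. - int n)"
  proof (rule UNIV_eq_I)
    fix m :: int
    show "m \<in> range int \<union> range (\<lambda>n. - int n)"
      by (cases m rule: int_cases2) simp_all
  qed
  moreover have "(\<lambda>m::int. norm (q powi (m\<^sup>2))) summable_on (range int \<union> range (\<lambda>n. - int n))"
    by (rule summable_on_union[OF pos neg])
  ultimately show ?thesis by simp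
qed

end

theory Submission
  imports Defs "HOL-Probability.Distributions"
begin

text \<open>
  With \<open>q = exp (- pi * s)\<close> and \<open>s = sqrt (2 * n)\<close>, the identity
  \<open>theta3(q) theta4(q) = theta4(q\<^sup>2)\<^sup>2\<close> gives \<open>h'(2, n) ^ 4 = k'(s) / 2\<close>, where
  \<open>k = theta2\<^sup>2 / theta3\<^sup>2\<close> and \<open>k' = theta4\<^sup>2 / theta3\<^sup>2\<close>, so singular moduli are to be computed.
  Three relations suffice: \<open>k(2 s) = (1 - k'(s)) / (1 + k'(s))\<close>, the cubic modular equation
  \<open>sqrt (k(s) k(3 s)) + sqrt (k'(s) k'(3 s)) = 1\<close>, and the inversion \<open>k(1 / s) = k'(s)\<close>.
  The first two come from rearranging double series. For the inversion,
  \<open>(theta3(s)\<^sup>2, theta4(s)\<^sup>2)\<close> and \<open>(theta3(1 / s)\<^sup>2, theta2(1 / s)\<^sup>2) / s\<close> both perform a step of the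
  arithmetic-geometric mean when \<open>s\<close> is doubled, and both tend to 1; the second limit is
  the Gaussian integral. The relations then become polynomial equations at \<open>s\<close> among
  \<open>sqrt 2\<close>, \<open>sqrt (2/3)\<close>, \<open>sqrt 6\<close>, \<open>sqrt 2 / 3\<close>, \<open>3 * sqrt 2\<close>, and a crude monotonicity estimate
  separates their two admissible roots.
\<close>

subsection \<open>Theta series and their quadratic and cubic identities\<close>

definition theta3 :: "real \<Rightarrow> real" where
  "theta3 s = ramanujan_phi (exp (- (pi * s)))"

definition theta4 :: "real \<Rightarrow> real" where
  "theta4 s = ramanujan_phi (- exp (- (pi * s)))"

definition gauss :: "real \<Rightarrow> int \<Rightarrow> real" where
  "gauss s m = exp (- (pi * s * (real_of_int m)\<^sup>2))"

text \<open>The half-integers in the usual series for \<open>theta2\<close> are written as halves of odd numbers.\<close>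

definition theta2 :: "real \<Rightarrow> real" where
  "theta2 s = infsum (gauss (s / 4)) {m. odd m}"

lemma gauss_pos [simp]: "gauss s m > 0"
  by (simp add: gauss_def)

lemma exp_powi_square: "exp (- (pi * s)) powi (m\<^sup>2) = gauss s m"
  using exp_power_int[of "- (pi * s)" "m\<^sup>2"] by (simp add: gauss_def algebra_simps)

lemma has_sum_gauss:
  assumes "s > 0"
  shows "(gauss s has_sum theta3 s) UNIV"
proof -
  have "(\<lambda>m. exp (- (pi * s)) powi (m\<^sup>2)) summable_on (UNIV :: int set)"
    using assms by (intro abs_summable_summable[OF ramanujan_phi_abs_summable]) simp
  then show ?thesis
    unfolding theta3_def ramanujan_phi_def exp_powi_square by (rule has_sum_infsum)
qed

lemma gauss_summable: "s > 0 \<Longrightarrow> gauss s summable_on X"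
  by (rule summable_on_subset[OF has_sum_imp_summable[OF has_sum_gauss]]) auto

lemma gauss_even_has_sum:
  assumes "s > 0"
  shows "(gauss s has_sum theta3 (4 * s)) {m. even m}"
proof -
  have "(gauss s has_sum theta3 (4 * s)) {m. even m} \<longleftrightarrow> (gauss (4 * s) has_sum theta3 (4 * s)) UNIV"
    by (rule has_sum_reindex_bij_witness[where i="\<lambda>m. 2 * m" and j="\<lambda>m. m div 2"])
       (auto simp: gauss_def)
  then show ?thesis using has_sum_gauss[of "4 * s"] assms by simp
qed

lemma gauss_odd_has_sum:
  assumes "s > 0"
  shows "(gauss s has_sum theta2 (4 * s)) {m. odd m}"
  unfolding theta2_def using gauss_summable[OF assms] by simp

lemma theta3_split:
  assumes "s > 0"
  shows "theta3 s = theta3 (4 * s) + theta2 (4 * s)"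
proof -
  have "(gauss s has_sum (theta3 (4 * s) + theta2 (4 * s))) ({m. even m} \<union> {m. odd m})"
    by (intro has_sum_Un_disjoint gauss_even_has_sum gauss_odd_has_sum assms) auto
  moreover have "{m::int. even m} \<union> {m. odd m} = UNIV" by auto
  ultimately show ?thesis using has_sum_gauss[OF assms] has_sum_unique by metis
qed

text \<open>Since \<open>m\<^sup>2\<close> has the parity of \<open>m\<close>, the negative base
  changes the sign of exactly the odd terms.\<close>

lemma theta4_split:
  assumes "s > 0"
  shows "theta4 s = theta3 (4 * s) - theta2 (4 * s)"
proof -
  let ?f = "\<lambda>m::int. if even m then gauss s m else - gauss s m"
  have "(?f has_sum theta3 (4 * s)) {m. even m}"
    using gauss_even_has_sum[OF assms] by (rule has_sum_cong[THEN iffD1, rotated]) auto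
  moreover have "(?f has_sum - theta2 (4 * s)) {m. odd m}"
    using has_sum_uminusI[OF gauss_odd_has_sum[OF assms]]
    by (rule has_sum_cong[THEN iffD1, rotated]) auto
  ultimately have "(?f has_sum (theta3 (4 * s) + - theta2 (4 * s))) ({m. even m} \<union> {m. odd m})"
    by (intro has_sum_Un_disjoint) auto
  moreover have "{m::int. even m} \<union> {m. odd m} = UNIV" by auto
  moreover have "(- exp (- (pi * s))) powi (m\<^sup>2) = ?f m" for m :: int
    unfolding power_int_minus_left exp_powi_square by simp
  ultimately show ?thesis
    unfolding theta4_def ramanujan_phi_def by (simp add: infsumI)
qed

section \<open>Double series and changes of lattice variables\<close>

lemma has_sum_mult_nonneg:
  fixes f :: "'a \<Rightarrow> real" and g :: "'b \<Rightarrow> real"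
  assumes f: "(f has_sum a) X" and g: "(g has_sum b) Y"
    and nonneg: "\<And>x. f x \<ge> 0" "\<And>y. g y \<ge> 0"
  shows "((\<lambda>(x, y). f x * g y) has_sum (a * b)) (X \<times> Y)"
proof -
  \<comment> \<open>For nonnegative terms, summability of the row sums \<open>f x * b\<close> gives
    summability over the product.\<close>
  have "(\<lambda>(x, y). f x * g y) summable_on X \<times> Y"
  proof (rule summable_on_SigmaI)
    show "((\<lambda>y. case (x, y) of (x, y) \<Rightarrow> f x * g y) has_sum f x * b) Y" for x
      using has_sum_cmult_right[OF g] by simp
    show "(\<lambda>x. f x * b) summable_on X"
      using has_sum_cmult_left[OF f] by (rule has_sum_imp_summable)
  qed (use nonneg in auto)
  then show ?thesis
    using has_sum_cmult_right[OF g] has_sum_cmult_left[OF f]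
    by (intro has_sum_SigmaI) auto
qed

lemma has_sum_reindex_pairs:
  fixes h :: "'a \<times> 'b \<Rightarrow> 'c \<times> 'd"
  assumes "inj_on h A"
    and "\<And>x y. (x, y) \<in> A \<Longrightarrow> h (x, y) \<in> B"
    and "\<And>a b. (a, b) \<in> B \<Longrightarrow> \<exists>x y. (x, y) \<in> A \<and> (a, b) = h (x, y)"
    and "\<And>x y. (x, y) \<in> A \<Longrightarrow> G (h (x, y)) = F (x, y)"
  shows "(F has_sum S) A \<longleftrightarrow> (G has_sum S) B"
proof -
  have "(F has_sum S) A \<longleftrightarrow> ((\<lambda>x. G (h x)) has_sum S) A"
    using assms(4) by (intro has_sum_cong) auto
  also have "bij_betw h A B"
    unfolding bij_betw_def
  proof (intro conjI equalityI subsetI)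
    fix z assume "z \<in> B"
    then show "z \<in> h ` A" using assms(3)[of "fst z" "snd z"] by force
  qed (use assms(1,2) in auto)
  then have "((\<lambda>x. G (h x)) has_sum S) A \<longleftrightarrow> (G has_sum S) B"
    by (rule has_sum_reindex_bij_betw)
  finally show ?thesis .
qed

text \<open>The parallelogram identity \<open>(u + v)\<^sup>2 + (u - v)\<^sup>2 = 2 * (u\<^sup>2 +
  v\<^sup>2)\<close> rewrites the double series of the left side; the parity of \<open>m + n\<close>
  separates the two squares on the right.\<close>

lemma theta3_double:
  assumes "s > 0"
  shows "(theta3 s)\<^sup>2 = (theta3 (2 * s))\<^sup>2 + (theta2 (2 * s))\<^sup>2"
proof -
  define F where "F = (\<lambda>(m, n). gauss s m * gauss s n)"
  define P where "P = {(m::int, n::int). even (m + n)}"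
  define Q where "Q = {(m::int, n::int). odd (m + n)}"
  have "(F has_sum theta3 s * theta3 s) (UNIV \<times> UNIV)"
    unfolding F_def by (intro has_sum_mult_nonneg has_sum_gauss assms less_imp_le gauss_pos)
  moreover have "(F has_sum theta3 (2 * s) * theta3 (2 * s)) P"
  proof -
    define h where "h = (\<lambda>(u::int, v::int). (u + v, u - v))"
    define G where "G = (\<lambda>(u, v). gauss (2 * s) u * gauss (2 * s) v)"
    have "(G has_sum theta3 (2 * s) * theta3 (2 * s)) (UNIV \<times> UNIV)"
      using has_sum_mult_nonneg[OF has_sum_gauss has_sum_gauss, of "2 * s" "2 * s"] assms
      by (simp add: less_imp_le G_def)
    moreover have "(G has_sum t) (UNIV \<times> UNIV) \<longleftrightarrow> (F has_sum t) P" for t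
    proof (rule has_sum_reindex_pairs)
      show "inj_on h (UNIV \<times> UNIV)" by (auto simp: inj_on_def h_def)
      fix m n assume "(m, n) \<in> P"
      then have "even (m + n)" by (simp add: P_def)
      then obtain u where "m + n = 2 * u" by (elim evenE)
      then show "\<exists>u v. (u, v) \<in> UNIV \<times> UNIV \<and> (m, n) = h (u, v)"
        by (intro exI[of _ u] exI[of _ "m - u"]) (simp add: h_def)
    next
      fix u v
      have "pi * s * (real_of_int (u + v))\<^sup>2 + pi * s * (real_of_int (u - v))\<^sup>2
          = pi * (2 * s) * (real_of_int u)\<^sup>2 + pi * (2 * s) * (real_of_int v)\<^sup>2"
        by (simp add: power2_eq_square algebra_simps)
      then show "F (h (u, v)) = G (u, v)"
        by (simp add: F_def G_def h_def gauss_def flip: exp_add minus_add_distrib)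
    qed (auto simp: P_def h_def)
    ultimately show ?thesis by simp
  qed
  moreover have "(F has_sum theta2 (2 * s) * theta2 (2 * s)) Q"
  proof -
    \<comment> \<open>The substitution now runs from \<open>Q\<close> outwards, which avoids
      half-integers: \<open>m + n\<close> and \<open>m - n\<close> are odd, and \<open>s / 2\<close>
      is \<open>(2 * s) / 4\<close>, the scale in \<open>theta2 (2 * s)\<close>.\<close>
    define h where "h = (\<lambda>(m::int, n::int). (m + n, m - n))"
    define G where "G = (\<lambda>(u, v). gauss (s / 2) u * gauss (s / 2) v)"
    have "(G has_sum theta2 (2 * s) * theta2 (2 * s)) ({m. odd m} \<times> {m. odd m})"
      using has_sum_mult_nonneg[OF gauss_odd_has_sum gauss_odd_has_sum, of "s / 2" "s / 2"] assms
      by (simp add: less_imp_le G_def)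
    moreover have "(F has_sum t) Q \<longleftrightarrow> (G has_sum t) ({m. odd m} \<times> {m. odd m})" for t
    proof (rule has_sum_reindex_pairs)
      show "inj_on h Q" by (auto simp: inj_on_def h_def)
      fix u v :: int assume "(u, v) \<in> {m. odd m} \<times> {m. odd m}"
      then have uv: "odd u" "odd v" by auto
      then have "even (u + v)" by simp
      then obtain m where m: "u + v = 2 * m" by (elim evenE)
      then show "\<exists>m n. (m, n) \<in> Q \<and> (u, v) = h (m, n)"
        using uv by (intro exI[of _ m] exI[of _ "u - m"]) (simp add: h_def Q_def)
    next
      fix m n
      have "pi * s / 2 * (real_of_int (m + n))\<^sup>2 + pi * s / 2 * (real_of_int (m - n))\<^sup>2
          = pi * s * (real_of_int m)\<^sup>2 + pi * s * (real_of_int n)\<^sup>2"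
        by (simp add: power2_eq_square field_simps)
      then show "G (h (m, n)) = F (m, n)"
        by (simp add: F_def G_def h_def gauss_def flip: exp_add minus_add_distrib)
    qed (auto simp: Q_def h_def)
    ultimately show ?thesis by simp
  qed
  ultimately have "(F has_sum theta3 (2 * s) * theta3 (2 * s) + theta2 (2 * s) * theta2 (2 * s)) (P \<union> Q)"
    by (intro has_sum_Un_disjoint) (auto simp: P_def Q_def)
  moreover have "P \<union> Q = UNIV \<times> UNIV" by (auto simp: P_def Q_def)
  ultimately show ?thesis
    using \<open>(F has_sum theta3 s * theta3 s) (UNIV \<times> UNIV)\<close> has_sum_unique
    by (metis power2_eq_square)
qed

text \<open>
  This is the modular equation of degree 3. It rests on the two substitutions
  \<open>(a, b) = (x + 3 * y, \<plusminus> (x - y))\<close>, which turn \<open>(a\<^sup>2 + 3 * b\<^sup>2) / 4\<close> into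
  \<open>x\<^sup>2 + 3 * y\<^sup>2\<close> and send the pairs with \<open>x + y\<close> odd onto the two halves of the pairs
  of odd numbers \<open>a \<equiv> \<plusminus> b\<close> modulo 4.
\<close>

lemma theta_cubic:
  assumes "s > 0"
  shows "theta3 s * theta3 (3 * s) = theta4 s * theta4 (3 * s) + theta2 s * theta2 (3 * s)"
proof -
  define F where "F = (\<lambda>(m, n). gauss s m * gauss (3 * s) n)"
  define G where "G = (\<lambda>(a, b). gauss (s / 4) a * gauss (3 * s / 4) b)"
  define Q where "Q = {(m::int, n::int). odd (m + n)}"
  define Ev where "Ev = {m::int. even m}"
  define Od where "Od = {m::int. odd m}"
  have Q_split: "Q = Ev \<times> Od \<union> Od \<times> Ev" by (auto simp: Q_def Ev_def Od_def)
  have "(F has_sum theta3 (4 * s) * theta2 (12 * s)) (Ev \<times> Od)"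
    using has_sum_mult_nonneg[OF gauss_even_has_sum gauss_odd_has_sum, of s "3 * s"] assms
    by (simp add: less_imp_le F_def Ev_def Od_def)
  moreover have "(F has_sum theta2 (4 * s) * theta3 (12 * s)) (Od \<times> Ev)"
    using has_sum_mult_nonneg[OF gauss_odd_has_sum gauss_even_has_sum, of s "3 * s"] assms
    by (simp add: less_imp_le F_def Ev_def Od_def)
  ultimately have FQ: "(F has_sum theta3 (4 * s) * theta2 (12 * s) + theta2 (4 * s) * theta3 (12 * s)) Q"
    unfolding Q_split by (intro has_sum_Un_disjoint) (auto simp: Ev_def Od_def)
  define R where "R = (\<lambda>d::int. {(a, b). odd a \<and> odd b \<and> 4 dvd a - d * b})"
  have GR: "(F has_sum t) Q \<longleftrightarrow> (G has_sum t) (R d)" if d: "d = 1 \<or> d = - 1" for t d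
  proof (rule has_sum_reindex_pairs)
    define h where "h = (\<lambda>(x::int, y::int). (x + 3 * y, d * (x - y)))"
    show "inj_on h Q" using d by (auto simp: inj_on_def h_def)
    show "h (x, y) \<in> R d" if "(x, y) \<in> Q" for x y
      using that d by (auto simp: Q_def R_def h_def)
    show "\<exists>x y. (x, y) \<in> Q \<and> (a, b) = h (x, y)" if ab: "(a, b) \<in> R d" for a b
    proof -
      from ab obtain y where y: "a - d * b = 4 * y" by (auto simp: R_def)
      \<comment> \<open>Here \<open>d * d = 1\<close> is used. The preimage must satisfy
        \<open>x + 3 * y = a\<close> and \<open>x - y = a - 4 * y\<close>, hence
        \<open>x = a - 3 * y\<close>.\<close>
      have "b = d * (a - 4 * y)" using d y by auto
      moreover have "odd a" using ab by (simp add: R_def)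
      ultimately show ?thesis
        by (intro exI[of _ "a - 3 * y"] exI[of _ y]) (simp add: h_def Q_def)
    qed
    show "G (h (x, y)) = F (x, y)" for x y
    proof -
      have "(real_of_int (d * (x - y)))\<^sup>2 = (real_of_int (x - y))\<^sup>2"
        using d by (auto simp: power2_commute)
      moreover have "pi * s / 4 * (real_of_int (x + 3 * y))\<^sup>2 + pi * (3 * s) / 4 * (real_of_int (x - y))\<^sup>2
          = pi * s * (real_of_int x)\<^sup>2 + pi * (3 * s) * (real_of_int y)\<^sup>2"
        by (simp add: power2_eq_square field_simps)
      ultimately show ?thesis
        by (simp add: F_def G_def h_def gauss_def flip: exp_add minus_add_distrib)
    qed
  qed
  have "4 dvd a - b \<or> 4 dvd a + b" if "odd a" "odd b" for a b :: int
    using that by presburger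
  then have "R 1 \<union> R (- 1) = Od \<times> Od"
    by (auto simp: R_def Od_def)
  moreover have "\<not> (4 dvd a - b \<and> 4 dvd a + b)" if "odd a" for a b :: int
    using that by presburger
  then have "R 1 \<inter> R (- 1) = {}"
    by (auto simp: R_def)
  ultimately have "(G has_sum (theta3 (4 * s) * theta2 (12 * s) + theta2 (4 * s) * theta3 (12 * s)) +
      (theta3 (4 * s) * theta2 (12 * s) + theta2 (4 * s) * theta3 (12 * s))) (Od \<times> Od)"
    using has_sum_Un_disjoint GR FQ by (metis (no_types, lifting))
  moreover have "(G has_sum theta2 s * theta2 (3 * s)) (Od \<times> Od)"
    using has_sum_mult_nonneg[OF gauss_odd_has_sum gauss_odd_has_sum, of "s / 4" "3 * s / 4"] assms
    by (simp add: less_imp_le G_def Od_def)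
  ultimately have "theta2 s * theta2 (3 * s) =
      2 * (theta3 (4 * s) * theta2 (12 * s) + theta2 (4 * s) * theta3 (12 * s))"
    using has_sum_unique by fastforce
  \<comment> \<open>With the splittings at \<open>s\<close> and \<open>3 * s\<close>, the claim is
    \<open>(A + B) * (C + D) - (A - B) * (C - D) = 2 * (A * D + B * C)\<close>.\<close>
  moreover have "theta3 (3 * s) = theta3 (12 * s) + theta2 (12 * s)"
      "theta4 (3 * s) = theta3 (12 * s) - theta2 (12 * s)"
    using theta3_split[of "3 * s"] theta4_split[of "3 * s"] assms by simp_all
  moreover note theta3_split[OF assms] theta4_split[OF assms]
  ultimately show ?thesis by algebra
qed

subsection \<open>Comparison with the Gaussian integral\<close>

lemma integral_gaussian_tendsto:
  assumes "s > 0"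
  shows "(\<lambda>n. integral {0..real n} (\<lambda>x. exp (- (pi * s * x\<^sup>2)))) \<longlonglongrightarrow> 1 / (2 * sqrt s)"
proof -
  \<comment> \<open>Substituting \<open>c * x\<close> reduces the integrand to the standard Gaussian
    on the half-line.\<close>
  define c where "c = sqrt (pi * s)"
  have c: "c > 0" "c\<^sup>2 = pi * s" "sqrt pi / 2 / c = 1 / (2 * sqrt s)"
    using assms by (simp_all add: c_def) (simp add: real_sqrt_mult)
  define f where "f = (\<lambda>x::real. exp (- (pi * s * x\<^sup>2)))"
  have "has_bochner_integral lborel (\<lambda>x. indicator {0..} (0 + c * x) *\<^sub>R exp (- (0 + c * x)\<^sup>2))
      ((sqrt pi / 2) /\<^sub>R \<bar>c\<bar>)"
    using lborel_has_bochner_integral_real_affine_iff[THEN iffD1, OF _ gaussian_moment_0, of c 0] c(1)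
    by simp
  moreover have "indicator {0..} (0 + c * x) *\<^sub>R exp (- (0 + c * x)\<^sup>2) = indicator {0..} x *\<^sub>R f x" for x
    using c by (auto simp: indicator_def f_def power_mult_distrib zero_le_mult_iff)
  moreover have "(sqrt pi / 2) /\<^sub>R \<bar>c\<bar> = 1 / (2 * sqrt s)"
    using c by (simp add: field_simps)
  ultimately have "has_bochner_integral lborel (\<lambda>x. indicator {0..} x *\<^sub>R f x) (1 / (2 * sqrt s))"
    by (simp add: mult.commute)
  then have "((\<lambda>y. \<integral>x. indicator {..y} x *\<^sub>R (indicator {0..} x *\<^sub>R f x) \<partial>lborel) \<longlongrightarrow> 1 / (2 * sqrt s)) at_top"
    using tendsto_integral_at_top[of lborel "\<lambda>x. indicator {0..} x *\<^sub>R f x"]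
    by (simp add: has_bochner_integral_iff)
  then have "(\<lambda>n. \<integral>x. indicator {..real n} x *\<^sub>R (indicator {0..} x *\<^sub>R f x) \<partial>lborel) \<longlonglongrightarrow> 1 / (2 * sqrt s)"
    by (rule filterlim_compose[OF _ filterlim_real_sequentially])
  moreover have "(\<integral>x. indicator {..real n} x *\<^sub>R (indicator {0..} x *\<^sub>R f x) \<partial>lborel)
      = integral {0..real n} f" for n
  proof -
    have "set_integrable lborel {0..real n} f"
      by (rule borel_integrable_atLeastAtMost') (auto simp: f_def intro!: continuous_intros)
    moreover have "indicator {..real n} x *\<^sub>R (indicator {0..} x *\<^sub>R f x) = indicator {0..real n} x *\<^sub>R f x" for x
      by (auto simp: indicator_def)
    ultimately show ?thesis
      using set_borel_integral_eq_integral(2)[of "{0..real n}" f]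
      unfolding set_lebesgue_integral_def by (simp only:)
  qed
  ultimately show ?thesis by (simp add: f_def)
qed

text \<open>The summand is even, so with \<open>p\<close> the sum over positive \<open>m\<close> the
  whole series is \<open>1 + 2 * p\<close> and the one-sided series is \<open>1 + p\<close>.\<close>

lemma gauss_sums:
  assumes "s > 0"
  shows "(\<lambda>n. gauss s (int n)) sums ((theta3 s + 1) / 2)"
proof -
  define p where "p = infsum (gauss s) {m. m > 0}"
  have pos: "(gauss s has_sum p) {m. m > 0}"
    unfolding p_def using gauss_summable[OF assms] by simp
  have "(gauss s has_sum p) {m. m < 0} \<longleftrightarrow> (gauss s has_sum p) {m. m > 0}"
    by (rule has_sum_reindex_bij_witness[where i=uminus and j=uminus]) (auto simp: gauss_def)
  with pos have "(gauss s has_sum p) {m. m < 0}" by simp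
  moreover have "(gauss s has_sum (gauss s 0 + p)) (insert 0 {m. m > 0})"
    using pos by (intro has_sum_insert) auto
  moreover have "insert 0 {m. m > 0} = {m::int. m \<ge> 0}" by auto
  ultimately have neg: "(gauss s has_sum p) {m. m < 0}"
    and nonneg: "(gauss s has_sum (1 + p)) {m. m \<ge> 0}"
    by (simp_all add: gauss_def)
  then have "(gauss s has_sum (p + (1 + p))) ({m. m < 0} \<union> {m. m \<ge> 0})"
    by (intro has_sum_Un_disjoint) auto
  moreover have "{m::int. m < 0} \<union> {m. m \<ge> 0} = UNIV" by auto
  ultimately have p: "theta3 s = p + (1 + p)"
    using has_sum_gauss[OF assms] has_sum_unique by metis
  have "((\<lambda>n. gauss s (int n)) has_sum (1 + p)) UNIV \<longleftrightarrow> (gauss s has_sum (1 + p)) {m. m \<ge> 0}"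
    by (rule has_sum_reindex_bij_witness[where i=nat and j=int]) auto
  moreover have "1 + p = (theta3 s + 1) / 2" using p by simp
  ultimately show ?thesis using nonneg has_sum_imp_sums by metis
qed

text \<open>Integral test: the partial sums minus the integrals decrease from \<open>f 0 = 1\<close>
  and stay nonnegative, so their limit, half of \<open>theta3 s + 1 - 1 / sqrt s\<close>, lies
  between 0 and 1.\<close>

lemma theta3_bound:
  assumes "s > 0"
  shows "\<bar>theta3 s - 1 / sqrt s\<bar> \<le> 1"
proof -
  define f where "f = (\<lambda>x::real. exp (- (pi * s * x\<^sup>2)))"
  interpret antimono_fun_sum_integral_diff f
  proof
    show "f x \<ge> f y" if "x \<ge> 0" "x \<le> y" for x y
      using that assms by (auto simp: f_def intro!: power_mono)
  qed (auto simp: f_def intro!: continuous_intros)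
  have "sum_integral_diff_series \<longlonglongrightarrow> (theta3 s + 1) / 2 - 1 / (2 * sqrt s)"
    unfolding sum_integral_diff_series_def
  proof (rule tendsto_diff)
    show "(\<lambda>n. \<Sum>k\<le>n. f (real k)) \<longlonglongrightarrow> (theta3 s + 1) / 2"
      using gauss_sums[OF assms] by (simp add: sums_def_le gauss_def f_def)
    show "(\<lambda>n. integral {0..real n} f) \<longlonglongrightarrow> 1 / (2 * sqrt s)"
      unfolding f_def by (rule integral_gaussian_tendsto[OF assms])
  qed
  moreover have "sum_integral_diff_series n \<in> {0..1}" for n
    using sum_integral_diff_series_nonneg[of n] sum_integral_diff_series_antimono[of 0 n]
    by (simp add: sum_integral_diff_series_def[of 0]) (simp add: f_def)
  ultimately have "(theta3 s + 1) / 2 - 1 / (2 * sqrt s) \<in> {0..1}"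
    by (rule Lim_in_closed_set[OF closed_atLeastAtMost always_eventually[OF allI] sequentially_bot, rotated])
  then show ?thesis by (simp add: abs_le_iff field_simps)
qed

section \<open>Elementary bounds from single terms\<close>

lemma theta3_ge_1:
  assumes "s > 0"
  shows "theta3 s \<ge> 1"
proof -
  have "(gauss s has_sum gauss s 0) {0}" by (rule has_sum_finiteI) auto
  from has_sum_mono2[OF this has_sum_gauss[OF assms]] show ?thesis
    by (simp add: gauss_def less_imp_le)
qed

lemma theta2_has_sum:
  assumes "s > 0"
  shows "(gauss (s / 4) has_sum theta2 s) {m. odd m}"
  using gauss_odd_has_sum[of "s / 4"] assms by simp

lemma theta2_pos:
  assumes "s > 0"
  shows "theta2 s > 0"
proof -
  have "(gauss (s / 4) has_sum gauss (s / 4) 1) {1}" by (rule has_sum_finiteI) auto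
  from has_sum_mono2[OF this theta2_has_sum[OF assms]]
  have "gauss (s / 4) 1 \<le> theta2 s" by (simp add: less_imp_le)
  then show ?thesis using gauss_pos[of "s / 4" 1] by linarith
qed

text \<open>The bound holds term by term, because an odd \<open>m\<close> has
  \<open>m\<^sup>2 \<ge> 1\<close>.\<close>

lemma theta2_decay:
  assumes "0 < s" "s \<le> t"
  shows "theta2 t \<le> exp (- (pi * (t - s) / 4)) * theta2 s"
proof (rule has_sum_mono)
  show "(gauss (t / 4) has_sum theta2 t) {m. odd m}"
    using assms by (intro theta2_has_sum) simp
  show "((\<lambda>m. exp (- (pi * (t - s) / 4)) * gauss (s / 4) m) has_sum
      exp (- (pi * (t - s) / 4)) * theta2 s) {m. odd m}"
    using assms by (intro has_sum_cmult_right theta2_has_sum)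
  fix m :: int assume "m \<in> {m. odd m}"
  then have "m \<noteq> 0" by auto
  then have "1 \<le> m\<^sup>2" by (smt (verit) zero_less_power2)
  then have "1 \<le> (real_of_int m)\<^sup>2" by (metis of_int_1_le_iff of_int_power)
  then have "pi * (t - s) / 4 * 1 \<le> pi * (t - s) / 4 * (real_of_int m)\<^sup>2"
    using assms by (intro mult_left_mono) auto
  then show "gauss (t / 4) m \<le> exp (- (pi * (t - s) / 4)) * gauss (s / 4) m"
    by (simp add: gauss_def algebra_simps diff_divide_distrib flip: exp_add)
qed

subsection \<open>Inversion through the arithmetic-geometric mean\<close>

lemma theta2_double:
  assumes "s > 0"
  shows "(theta2 s)\<^sup>2 = 2 * theta3 (2 * s) * theta2 (2 * s)"
  \<comment> \<open>Both expressions for \<open>(theta3 (s / 2))\<^sup>2\<close> are compared; the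
    squares cancel and the cross term remains.\<close>
  using theta3_double[of "s / 2"] theta3_split[of "s / 2"] theta3_double[of s] assms
  by (simp add: power2_eq_square algebra_simps)

lemma theta4_double:
  assumes "s > 0"
  shows "(theta4 s)\<^sup>2 = (theta3 (2 * s))\<^sup>2 - (theta2 (2 * s))\<^sup>2"
proof -
  have "(theta3 (2 * s))\<^sup>2 = (theta3 (4 * s))\<^sup>2 + (theta2 (4 * s))\<^sup>2"
      "(theta2 (2 * s))\<^sup>2 = 2 * theta3 (4 * s) * theta2 (4 * s)"
    using theta3_double[of "2 * s"] theta2_double[of "2 * s"] assms by simp_all
  with theta4_split[OF assms] show ?thesis by algebra
qed

lemma theta3_theta4:
  assumes "s > 0"
  shows "theta3 s * theta4 s = (theta4 (2 * s))\<^sup>2"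
proof -
  have "(theta4 (2 * s))\<^sup>2 = (theta3 (4 * s))\<^sup>2 - (theta2 (4 * s))\<^sup>2"
    using theta4_double[of "2 * s"] assms by simp
  with theta3_split[OF assms] theta4_split[OF assms] show ?thesis by algebra
qed

text \<open>In the difference of squares, the doubling formulas turn the two factors into
  \<open>2 * (theta3 (2 * s))\<^sup>2\<close> and
  \<open>2 * (theta2 (2 * s))\<^sup>2\<close>.\<close>

lemma theta_quartic:
  assumes "s > 0"
  shows "theta3 s ^ 4 = theta2 s ^ 4 + theta4 s ^ 4"
proof -
  have "theta3 s ^ 4 - theta4 s ^ 4
      = ((theta3 s)\<^sup>2 + (theta4 s)\<^sup>2) * ((theta3 s)\<^sup>2 - (theta4 s)\<^sup>2)"
    by algebra
  also have "\<dots> = (2 * theta3 (2 * s) * theta2 (2 * s))\<^sup>2"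
    unfolding theta3_double[OF assms] theta4_double[OF assms] by algebra
  also have "\<dots> = theta2 s ^ 4"
    unfolding theta2_double[OF assms, symmetric] by simp
  finally show ?thesis by simp
qed

lemma theta3_upper:
  assumes "s > 0"
  shows "theta3 s \<le> 1 + 1 / sqrt s"
  using theta3_bound[OF assms] by linarith

text \<open>By \<open>theta3_theta4\<close>, a nonpositive value at \<open>s\<close> forces zeros at
  \<open>2 * s\<close>, \<open>4 * s\<close> and so on; but for \<open>t > 1\<close> the splittings
  give \<open>theta4 t = 2 * theta3 (4 * t) - theta3 t > 2 - 2\<close>.\<close>

lemma theta4_pos:
  assumes "s > 0"
  shows "theta4 s > 0"
proof (rule ccontr)
  assume "\<not> theta4 s > 0"
  have "theta4 (2 ^ n * s) \<le> 0" for n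
  proof (induction n)
    case (Suc n)
    have "(theta4 (2 ^ Suc n * s))\<^sup>2 = theta3 (2 ^ n * s) * theta4 (2 ^ n * s)"
      using theta3_theta4[of "2 ^ n * s"] assms by (simp add: mult.assoc)
    also have "\<dots> \<le> 0"
      using Suc theta3_ge_1[of "2 ^ n * s"] assms by (intro mult_nonneg_nonpos) auto
    finally show ?case by simp
  qed (use \<open>\<not> theta4 s > 0\<close> in simp)
  moreover obtain n where "1 / s < 2 ^ n"
    using real_arch_pow[of 2 "1 / s"] by auto
  then have n: "2 ^ n * s > 1" using assms by (simp add: field_simps)
  define t where "t = 2 ^ n * s"
  have t: "t > 1" using n by (simp add: t_def)
  have "theta4 t = 2 * theta3 (4 * t) - theta3 t"
    using theta3_split[of t] theta4_split[of t] t by simp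
  moreover have "theta3 (4 * t) \<ge> 1" using theta3_ge_1[of "4 * t"] t by simp
  moreover have "1 / sqrt t < 1" using t by simp
  ultimately show False
    using theta3_upper[of t] t unfolding t_def by (smt (verit))
qed

text \<open>
  After one step both components are strictly larger, hence larger by a factor \<open>c > 1\<close>, which
  survives in the limit by homogeneity of the arithmetic-geometric mean.
\<close>

lemma agm_strict_mono:
  fixes a b a' b' :: "nat \<Rightarrow> real"
  assumes pos: "\<And>n. a n > 0" "\<And>n. b n > 0" "\<And>n. b' n > 0"
    and step: "\<And>n. a (Suc n) = (a n + b n) / 2" "\<And>n. (b (Suc n))\<^sup>2 = a n * b n"
    and step': "\<And>n. a' (Suc n) = (a' n + b' n) / 2" "\<And>n. (b' (Suc n))\<^sup>2 = a' n * b' n"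
    and lim: "a \<longlonglongrightarrow> L" "a' \<longlonglongrightarrow> L'" and "L > 0"
    and le: "a 0 \<le> a' 0" and less: "b 0 < b' 0"
  shows "L < L'"
proof -
  have a1: "a 1 < a' 1" using le less step(1)[of 0] step'(1)[of 0] by simp
  have "a 0 * b 0 < a' 0 * b' 0"
    using le less pos(1)[of 0] pos(2)[of 0] by (intro mult_le_less_imp_less) auto
  then have "(b 1)\<^sup>2 < (b' 1)\<^sup>2" using step(2)[of 0] step'(2)[of 0] by simp
  then have b1: "b 1 < b' 1"
    by (rule power_less_imp_less_base) (rule less_imp_le[OF pos(3)])
  define c where "c = min (a' 1 / a 1) (b' 1 / b 1)"
  have c: "c > 1" "c * a 1 \<le> a' 1" "c * b 1 \<le> b' 1"
    using a1 b1 pos(1)[of 1] pos(2)[of 1] by (auto simp: c_def min_def field_simps)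
  have "c * a (Suc n) \<le> a' (Suc n) \<and> c * b (Suc n) \<le> b' (Suc n)" for n
  proof (induction n)
    case (Suc n)
    have "c * a (Suc (Suc n)) = (c * a (Suc n) + c * b (Suc n)) / 2"
      unfolding step(1)[of "Suc n"] by (simp add: field_simps)
    also have "\<dots> \<le> a' (Suc (Suc n))"
      unfolding step'(1)[of "Suc n"] using Suc by simp
    finally have "c * a (Suc (Suc n)) \<le> a' (Suc (Suc n))" .
    moreover have "0 < c * a (Suc n)" "0 < c * b (Suc n)"
      using c(1) pos(1,2)[of "Suc n"] by auto
    then have "(c * a (Suc n)) * (c * b (Suc n)) \<le> a' (Suc n) * b' (Suc n)"
      using Suc by (intro mult_mono) linarith+
    then have "(c * b (Suc (Suc n)))\<^sup>2 \<le> (b' (Suc (Suc n)))\<^sup>2"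
      unfolding power_mult_distrib step(2) step'(2) by (simp add: power2_eq_square mult_ac)
    then have "c * b (Suc (Suc n)) \<le> b' (Suc (Suc n))"
      by (rule power2_le_imp_le) (rule less_imp_le[OF pos(3)])
    ultimately show ?case by blast
  qed (use c in simp)
  then have "c * L \<le> L'"
    by (intro LIMSEQ_le[OF tendsto_mult_left[OF LIMSEQ_Suc[OF lim(1)]] LIMSEQ_Suc[OF lim(2)]]) blast
  moreover have "L < c * L" using c(1) \<open>L > 0\<close> by simp
  ultimately show ?thesis by linarith
qed

section \<open>Limits along repeated doubling\<close>

lemma tendsto_inverse_sqrt_power2:
  assumes "t > 0"
  shows "(\<lambda>n. 1 / sqrt (2 ^ n * t)) \<longlonglongrightarrow> 0"
proof -
  have "(\<lambda>n. 1 / sqrt t * (1 / sqrt 2) ^ n) \<longlonglongrightarrow> 1 / sqrt t * 0"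
    by (intro tendsto_mult_left LIMSEQ_power_zero) simp
  moreover have "1 / sqrt (2 ^ n * t) = 1 / sqrt t * (1 / sqrt 2) ^ n" for n
    by (simp add: real_sqrt_mult real_sqrt_power power_divide)
  ultimately show ?thesis by simp
qed

lemma theta3_tendsto:
  assumes "t > 0"
  shows "(\<lambda>n. theta3 (2 ^ n * t)) \<longlonglongrightarrow> 1"
proof (rule tendsto_sandwich[OF _ _ tendsto_const])
  show "(\<lambda>n. 1 + 1 / sqrt (2 ^ n * t)) \<longlonglongrightarrow> 1"
    using tendsto_add[OF tendsto_const tendsto_inverse_sqrt_power2[OF assms], of 1] by simp
  show "\<forall>\<^sub>F n in sequentially. 1 \<le> theta3 (2 ^ n * t)"
    using assms by (intro always_eventually allI theta3_ge_1) simp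
  show "\<forall>\<^sub>F n in sequentially. theta3 (2 ^ n * t) \<le> 1 + 1 / sqrt (2 ^ n * t)"
    using assms by (intro always_eventually allI theta3_upper) simp
qed

text \<open>At \<open>1 / u\<close>, \<open>theta3_bound\<close> keeps \<open>theta3 (1 / u)\<close>
  within 1 of \<open>sqrt u\<close>; division by \<open>sqrt u\<close> makes the error
  vanish.\<close>

lemma theta3_inverse_tendsto:
  assumes "t > 0"
  shows "(\<lambda>n. theta3 (1 / (2 ^ n * t)) / sqrt (2 ^ n * t)) \<longlonglongrightarrow> 1"
proof -
  have "\<bar>theta3 (1 / u) / sqrt u - 1\<bar> \<le> 1 / sqrt u" if "u > 0" for u
  proof -
    have "theta3 (1 / u) / sqrt u - 1 = (theta3 (1 / u) - sqrt u) / sqrt u"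
      using that by (simp add: field_simps)
    then have "\<bar>theta3 (1 / u) / sqrt u - 1\<bar> = \<bar>theta3 (1 / u) - sqrt u\<bar> / sqrt u"
      using that by (simp add: abs_divide)
    also have "\<dots> \<le> 1 / sqrt u"
      using theta3_bound[of "1 / u"] that by (intro divide_right_mono) (auto simp: real_sqrt_divide)
    finally show ?thesis .
  qed
  then have "\<forall>\<^sub>F n in sequentially.
      norm (theta3 (1 / (2 ^ n * t)) / sqrt (2 ^ n * t) - 1) \<le> 1 / sqrt (2 ^ n * t)"
    unfolding real_norm_def using assms by (intro always_eventually allI) simp
  then have "(\<lambda>n. theta3 (1 / (2 ^ n * t)) / sqrt (2 ^ n * t) - 1) \<longlonglongrightarrow> 0"
    by (rule Lim_null_comparison) (rule tendsto_inverse_sqrt_power2[OF assms])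
  then show ?thesis by (simp only: LIM_zero_iff)
qed

text \<open>Both pairs start AGM sequences with limit 1, so either domination would give
  \<open>1 < 1\<close> by \<open>agm_strict_mono\<close>.\<close>

lemma theta_inversion_comparison:
  assumes "t > 0"
  shows "\<not> ((theta3 t)\<^sup>2 \<le> (theta3 (1 / t))\<^sup>2 / t \<and> (theta4 t)\<^sup>2 < (theta2 (1 / t))\<^sup>2 / t)"
    and "\<not> ((theta3 (1 / t))\<^sup>2 / t \<le> (theta3 t)\<^sup>2 \<and> (theta2 (1 / t))\<^sup>2 / t < (theta4 t)\<^sup>2)"
proof -
  define T where "T = (\<lambda>n::nat. 2 ^ n * t)"
  have T: "T n > 0" "T (Suc n) = 2 * T n" for n using assms by (simp_all add: T_def)
  have T0: "T 0 = t" by (simp add: T_def)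
  define a where "a = (\<lambda>n. (theta3 (T n))\<^sup>2)"
  define b where "b = (\<lambda>n. (theta4 (T n))\<^sup>2)"
  define a' where "a' = (\<lambda>n. (theta3 (1 / T n))\<^sup>2 / T n)"
  define b' where "b' = (\<lambda>n. (theta2 (1 / T n))\<^sup>2 / T n)"
  have nz: "theta3 s \<noteq> 0" "theta4 s \<noteq> 0" "theta2 s \<noteq> 0" if "s > 0" for s
    using theta3_ge_1[OF that] theta4_pos[OF that] theta2_pos[OF that] by auto
  have pos: "a n > 0" "b n > 0" "a' n > 0" "b' n > 0" for n
    using T(1)[of n] nz by (simp_all add: a_def b_def a'_def b'_def)
  have step: "a (Suc n) = (a n + b n) / 2" "(b (Suc n))\<^sup>2 = a n * b n" for n
  proof -
    show "a (Suc n) = (a n + b n) / 2"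
      using theta3_double[OF T(1)[of n]] theta4_double[OF T(1)[of n]] by (simp add: a_def b_def T(2))
    have "b (Suc n) = theta3 (T n) * theta4 (T n)"
      using theta3_theta4[OF T(1)[of n]] by (simp add: b_def T(2))
    then show "(b (Suc n))\<^sup>2 = a n * b n"
      by (simp add: a_def b_def power_mult_distrib)
  qed
  have step': "a' (Suc n) = (a' n + b' n) / 2" "(b' (Suc n))\<^sup>2 = a' n * b' n" for n
  proof -
    \<comment> \<open>The doubling formulas are applied at \<open>1 / T (Suc n)\<close>, whose
      double is the previous argument.\<close>
    have *: "2 * (1 / T (Suc n)) = 1 / T n" "1 / T (Suc n) > 0"
      using T(1)[of n] by (simp_all add: T(2))
    show "a' (Suc n) = (a' n + b' n) / 2"
      using theta3_double[OF *(2)] T(1)[of n] unfolding *(1)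
      by (simp add: a'_def b'_def T(2) add_divide_distrib)
    have "b' (Suc n) = theta3 (1 / T n) * theta2 (1 / T n) / T n"
      using theta2_double[OF *(2)] T(1)[of n] unfolding *(1) by (simp add: b'_def T(2))
    then show "(b' (Suc n))\<^sup>2 = a' n * b' n"
      by (simp add: a'_def b'_def power_mult_distrib power_divide) (simp add: power2_eq_square)
  qed
  have lim: "a \<longlonglongrightarrow> 1"
    unfolding a_def T_def using tendsto_power[OF theta3_tendsto[OF assms], of 2] by simp
  have "(\<lambda>n. (theta3 (1 / T n) / sqrt (T n))\<^sup>2) \<longlonglongrightarrow> 1"
    unfolding T_def using tendsto_power[OF theta3_inverse_tendsto[OF assms], of 2] by simp
  moreover have "(theta3 (1 / T n) / sqrt (T n))\<^sup>2 = a' n" for n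
    using T(1)[of n] by (simp add: a'_def power_divide)
  ultimately have lim': "a' \<longlonglongrightarrow> 1" by simp
  show "\<not> ((theta3 t)\<^sup>2 \<le> (theta3 (1 / t))\<^sup>2 / t \<and> (theta4 t)\<^sup>2 < (theta2 (1 / t))\<^sup>2 / t)"
    using agm_strict_mono[of a b b' a', OF pos(1,2,4) step step' lim lim']
    by (auto simp: a_def b_def a'_def b'_def T0)
  show "\<not> ((theta3 (1 / t))\<^sup>2 / t \<le> (theta3 t)\<^sup>2 \<and> (theta2 (1 / t))\<^sup>2 / t < (theta4 t)\<^sup>2)"
    using agm_strict_mono[of a' b' b a, OF pos(3,4,2) step' step lim' lim]
    by (auto simp: a_def b_def a'_def b'_def T0)
qed

text \<open>
  Since \<open>theta3 ^ 4 = theta2 ^ 4 + theta4 ^ 4\<close>, the comparisons at \<open>t\<close> and at \<open>1 / t\<close> leave no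
  room for anything but equality, so no Poisson summation is needed.
\<close>

lemma theta_inversion:
  assumes t: "t > 0"
  shows "(theta3 (1 / t))\<^sup>2 = t * (theta3 t)\<^sup>2"
    and "(theta2 (1 / t))\<^sup>2 = t * (theta4 t)\<^sup>2"
proof -
  define a b c where "a = (theta3 t)\<^sup>2" and "b = (theta4 t)\<^sup>2" and "c = (theta2 t)\<^sup>2"
  define a' b' c' where "a' = (theta3 (1 / t))\<^sup>2 / t" and "b' = (theta2 (1 / t))\<^sup>2 / t"
    and "c' = (theta4 (1 / t))\<^sup>2 / t"
  note defs = a_def b_def c_def a'_def b'_def c'_def
  have nonneg: "a \<ge> 0" "b \<ge> 0" "c \<ge> 0" "a' \<ge> 0" "b' \<ge> 0" "c' \<ge> 0" using t by (auto simp: defs)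
  have sq: "a\<^sup>2 = b\<^sup>2 + c\<^sup>2" using theta_quartic[OF t] by (simp add: defs)
  have sq': "a'\<^sup>2 = b'\<^sup>2 + c'\<^sup>2"
    using theta_quartic[of "1 / t"] t by (simp add: defs power_divide field_simps)
  have 1: "\<not> (a \<le> a' \<and> b < b')" "\<not> (a' \<le> a \<and> b' < b)"
    using theta_inversion_comparison[OF t] by (simp_all add: defs)
  \<comment> \<open>At \<open>1 / t\<close> the comparison exchanges the two sides and brings in
    \<open>c\<close> and \<open>c'\<close>.\<close>
  have 2: "\<not> (a' \<le> a \<and> c' < c)" "\<not> (a \<le> a' \<and> c < c')"
    using theta_inversion_comparison[of "1 / t"] t by (simp_all add: defs field_simps)
  have "a = a' \<and> b = b'"
  proof (cases "a \<le> a'")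
    case True
    then have "b' \<le> b" "c' \<le> c" using 1 2 by auto
    then have "b'\<^sup>2 + c'\<^sup>2 \<le> b\<^sup>2 + c\<^sup>2" using nonneg by (intro add_mono power_mono) auto
    then have "a'\<^sup>2 \<le> a\<^sup>2" using sq sq' by simp
    then have "a' \<le> a" using nonneg(1) by (rule power2_le_imp_le)
    with True 1 show ?thesis by fastforce
  next
    case False
    then have "b \<le> b'" "c \<le> c'" using 1 2 by auto
    then have "b\<^sup>2 + c\<^sup>2 \<le> b'\<^sup>2 + c'\<^sup>2" using nonneg by (intro add_mono power_mono) auto
    then have "a\<^sup>2 \<le> a'\<^sup>2" using sq sq' by simp
    then have "a \<le> a'" using nonneg(4) by (rule power2_le_imp_le)
    with False show ?thesis by simp
  qed
  then show "(theta3 (1 / t))\<^sup>2 = t * (theta3 t)\<^sup>2" "(theta2 (1 / t))\<^sup>2 = t * (theta4 t)\<^sup>2"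
    using t by (auto simp: defs field_simps)
qed

subsection \<open>Singular moduli\<close>

text \<open>The square roots of the elliptic modulus and of the complementary modulus for the nome
  \<open>exp (- pi * s)\<close>.\<close>

definition sqrt_k :: "real \<Rightarrow> real" where
  "sqrt_k s = theta2 s / theta3 s"

definition sqrt_k' :: "real \<Rightarrow> real" where
  "sqrt_k' s = theta4 s / theta3 s"

lemma theta3_pos: "s > 0 \<Longrightarrow> theta3 s > 0"
  using theta3_ge_1[of s] by linarith

lemma sqrt_k_pos: "s > 0 \<Longrightarrow> sqrt_k s > 0"
  by (simp add: sqrt_k_def theta2_pos theta3_pos)

lemma sqrt_k'_pos: "s > 0 \<Longrightarrow> sqrt_k' s > 0"
  by (simp add: sqrt_k'_def theta4_pos theta3_pos)

lemma sqrt_k_quartic: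
  assumes "s > 0"
  shows "sqrt_k s ^ 4 + sqrt_k' s ^ 4 = 1"
proof -
  have "sqrt_k s ^ 4 + sqrt_k' s ^ 4 = theta3 s ^ 4 / theta3 s ^ 4"
    unfolding sqrt_k_def sqrt_k'_def power_divide add_divide_distrib[symmetric]
      theta_quartic[OF assms, symmetric] ..
  then show ?thesis using theta3_pos[OF assms] by simp
qed

lemma sqrt_k_inverse:
  assumes "s > 0"
  shows "sqrt_k (1 / s) = sqrt_k' s"
proof -
  have "(sqrt_k (1 / s))\<^sup>2 = (sqrt_k' s)\<^sup>2"
    using assms by (simp add: sqrt_k_def sqrt_k'_def power_divide theta_inversion)
  then show ?thesis
    using sqrt_k_pos[of "1 / s"] sqrt_k'_pos[OF assms] assms by (simp add: power2_eq_iff_nonneg)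
qed

text \<open>Landen's transformation: sum and difference of the doubling formulas, divided by
  \<open>(theta3 s)\<^sup>2\<close>.\<close>

lemma sqrt_k_landen:
  assumes "s > 0"
  shows "(sqrt_k (2 * s))\<^sup>2 * (1 + (sqrt_k' s)\<^sup>2) = 1 - (sqrt_k' s)\<^sup>2"
proof -
  have nz: "theta3 s \<noteq> 0" "theta3 (2 * s) \<noteq> 0"
    using theta3_pos[of s] theta3_pos[of "2 * s"] assms by auto
  have "1 + (sqrt_k' s)\<^sup>2 = 2 * (theta3 (2 * s))\<^sup>2 / (theta3 s)\<^sup>2"
    using nz theta3_double[OF assms] theta4_double[OF assms]
    by (simp add: sqrt_k'_def power_divide field_simps)
  moreover have "1 - (sqrt_k' s)\<^sup>2 = 2 * (theta2 (2 * s))\<^sup>2 / (theta3 s)\<^sup>2"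
    using nz theta3_double[OF assms] theta4_double[OF assms]
    by (simp add: sqrt_k'_def power_divide field_simps)
  ultimately show ?thesis
    using nz by (simp add: sqrt_k_def power_divide)
qed

lemma sqrt_k_cubic:
  assumes "s > 0"
  shows "sqrt_k s * sqrt_k (3 * s) + sqrt_k' s * sqrt_k' (3 * s) = 1"
proof -
  have "sqrt_k s * sqrt_k (3 * s) + sqrt_k' s * sqrt_k' (3 * s)
      = (theta4 s * theta4 (3 * s) + theta2 s * theta2 (3 * s)) / (theta3 s * theta3 (3 * s))"
    by (simp add: sqrt_k_def sqrt_k'_def add_divide_distrib)
  also have "\<dots> = 1"
    unfolding theta_cubic[OF assms, symmetric]
    using theta3_pos[of s] theta3_pos[of "3 * s"] assms by simp
  finally show ?thesis .
qed

text \<open>The hypothesis gives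
  \<open>theta3 s \<le> 1 + 1 / sqrt s < exp (pi * (t - s) / 4)\<close>, so the decay of
  \<open>theta2\<close> outweighs the denominator at \<open>s\<close>, while
  \<open>theta3 t \<ge> 1\<close>.\<close>

lemma sqrt_k_less:
  assumes "0 < s" "s < t" and less: "1 / sqrt s < pi * (t - s) / 4"
  shows "sqrt_k t < sqrt_k s"
proof -
  have "theta3 s < exp (pi * (t - s) / 4)"
    using theta3_upper[OF assms(1)] exp_ge_add_one_self[of "pi * (t - s) / 4"] less by linarith
  then have e: "exp (- (pi * (t - s) / 4)) < 1 / theta3 s"
    using theta3_pos[OF assms(1)] by (simp add: exp_minus field_simps)
  have "sqrt_k t \<le> theta2 t"
    using theta3_ge_1[of t] theta2_pos[of t] assms by (simp add: sqrt_k_def field_simps)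
  also have "\<dots> \<le> exp (- (pi * (t - s) / 4)) * theta2 s"
    using assms by (intro theta2_decay) auto
  also have "\<dots> < 1 / theta3 s * theta2 s"
    using e theta2_pos[OF assms(1)] by (rule mult_strict_right_mono)
  finally show ?thesis by (simp add: sqrt_k_def)
qed

text \<open>In the fourth power, \<open>theta3_theta4\<close> removes \<open>theta4 (2 * s)\<close>
  and leaves \<open>(sqrt_k' s)\<^sup>2 / 2\<close>; inversion turns this into
  \<open>sqrt_k\<close>.\<close>

lemma h'_2_eq:
  assumes "n > 0"
  shows "h' 2 n = root 4 ((sqrt_k (1 / sqrt (2 * n)))\<^sup>2 / 2)"
proof -
  define s where "s = sqrt (2 * n)"
  have s: "s > 0" using assms by (simp add: s_def)
  have "2 * sqrt (n / 2) = s"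
    unfolding s_def using assms by (simp add: real_sqrt_divide real_sqrt_mult field_simps)
  then have q: "exp (- 2 * pi * sqrt (n / 2)) = exp (- (pi * s))" by simp
  have "exp (- (pi * s)) powr 2 = exp (- (pi * (2 * s)))"
    by (simp add: powr_def)
  then have h: "h' 2 n = theta4 s / (2 powr (1/4) * theta4 (2 * s))"
    unfolding h'_def q Let_def theta4_def by simp
  have pos: "theta3 s > 0" "theta4 s > 0" "theta4 (2 * s) > 0"
    using s by (simp_all add: theta3_pos theta4_pos)
  have "theta4 (2 * s) ^ 4 = (theta3 s * theta4 s)\<^sup>2"
    unfolding theta3_theta4[OF s] by simp
  moreover have "(2 powr (1/4)) ^ 4 = (2::real)"
    by (simp add: powr_power)
  ultimately have "(h' 2 n) ^ 4 = theta4 s ^ 4 / (2 * (theta3 s * theta4 s)\<^sup>2)"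
    unfolding h by (simp add: power_divide power_mult_distrib)
  also have "\<dots> = (sqrt_k' s)\<^sup>2 / 2"
    using pos by (simp add: sqrt_k'_def field_simps power2_eq_square power4_eq_xxxx)
  also have "sqrt_k' s = sqrt_k (1 / s)" using sqrt_k_inverse[OF s] by simp
  finally have "(h' 2 n) ^ 4 = (sqrt_k (1 / s))\<^sup>2 / 2" .
  moreover have "h' 2 n \<ge> 0" unfolding h using pos by simp
  ultimately show ?thesis unfolding s_def using real_root_pos_unique[of 4] by simp
qed

section \<open>Moduli at the special arguments\<close>

lemma sqrt_k_sqrt2: "(sqrt_k (sqrt 2))\<^sup>2 = sqrt 2 - 1"
proof -
  define z where "z = (sqrt_k (sqrt 2))\<^sup>2"
  \<comment> \<open>The double of \<open>1 / sqrt 2\<close> is also its reciprocal, so the Landen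
    relation closes into an equation for \<open>z\<close>.\<close>
  have "2 * (1 / sqrt 2) = sqrt 2" by (simp add: real_div_sqrt)
  then have "z * (1 + z) = 1 - z"
    using sqrt_k_landen[of "1 / sqrt 2"] sqrt_k_inverse[of "1 / sqrt 2"] by (simp add: z_def)
  then have "(z + 1)\<^sup>2 = 2" by algebra
  moreover have "z + 1 \<ge> 0" by (simp add: z_def)
  ultimately have "sqrt 2 = z + 1" by (intro real_sqrt_unique)
  then show ?thesis by (simp add: z_def)
qed

text \<open>For \<open>t = sqrt (2/3)\<close> the number \<open>3 * t\<close> equals
  \<open>2 / t\<close>, so \<open>x\<close> and \<open>y\<close> satisfy both the Landen and the
  cubic relation. These determine first \<open>u = x * y\<close>, then \<open>x\<^sup>2\<close> and
  \<open>y\<^sup>2\<close> from their sum and product.\<close>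

lemma sqrt_k_two_thirds:
  shows "(sqrt_k (sqrt (2/3)))\<^sup>2 = (2 - sqrt 3) * (sqrt 3 + sqrt 2)"
    and "(sqrt_k (sqrt 6))\<^sup>2 = (2 - sqrt 3) * (sqrt 3 - sqrt 2)"
proof -
  define t where "t = sqrt (2/3)"
  have t: "t > 0" by (simp add: t_def)
  have "sqrt 6 = sqrt (9 * (2/3))" by simp
  then have t3: "sqrt 6 = 3 * t"
    unfolding t_def real_sqrt_mult by simp
  have "t * t = 2/3" by (simp add: t_def)
  then have t2: "2 * (1 / t) = 3 * t" using t by (simp add: field_simps)
  define x y where "x = sqrt_k t" and "y = sqrt_k (3 * t)"
  define x' y' where "x' = sqrt_k' t" and "y' = sqrt_k' (3 * t)"
  have pos: "x > 0" "y > 0" "x' > 0" "y' > 0"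
    using t by (simp_all add: x_def y_def x'_def y'_def sqrt_k_pos sqrt_k'_pos)
  have landen: "y\<^sup>2 * (1 + x\<^sup>2) = 1 - x\<^sup>2"
    using sqrt_k_landen[of "1 / t"] sqrt_k_inverse[of "1 / t"] t unfolding t2 by (simp add: x_def y_def)
  have quartic: "x ^ 4 + x' ^ 4 = 1" "y ^ 4 + y' ^ 4 = 1"
    using sqrt_k_quartic[of t] sqrt_k_quartic[of "3 * t"] t by (simp_all add: x_def y_def x'_def y'_def)
  have cubic: "x * y + x' * y' = 1"
    using sqrt_k_cubic[OF t] by (simp add: x_def y_def x'_def y'_def)
  define u where "u = x * y"
  define v where "v = x' * y'"
  have uv: "u > 0" "v > 0" "v = 1 - u" using pos cubic by (simp_all add: u_def v_def)
  have sum: "x\<^sup>2 + y\<^sup>2 = 1 - u\<^sup>2" using landen by (simp add: u_def power_mult_distrib algebra_simps)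
  have "v ^ 4 = (1 - x ^ 4) * (1 - y ^ 4)"
    using quartic by (simp add: v_def power_mult_distrib flip: quartic)
  also have "\<dots> = 1 - ((x\<^sup>2 + y\<^sup>2)\<^sup>2 - 2 * u\<^sup>2) + u ^ 4" unfolding u_def by algebra
  also have "\<dots> = (2 * u)\<^sup>2" unfolding sum by algebra
  finally have "(v\<^sup>2)\<^sup>2 = (2 * u)\<^sup>2" by simp
  then have "v\<^sup>2 = 2 * u" by (rule power2_eq_imp_eq) (use uv(1) in auto)
  then have "(2 - u)\<^sup>2 = 3" unfolding uv(3) by algebra
  moreover have "2 - u \<ge> 0" using uv by simp
  ultimately have "sqrt 3 = 2 - u" by (intro real_sqrt_unique)
  then have u: "u = 2 - sqrt 3" by simp
  \<comment> \<open>\<open>r\<close> and \<open>r'\<close> have the same sum and product as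
    \<open>x\<^sup>2\<close> and \<open>y\<^sup>2\<close>.\<close>
  define r where "r = (2 - sqrt 3) * (sqrt 3 + sqrt 2)"
  define r' where "r' = (2 - sqrt 3) * (sqrt 3 - sqrt 2)"
  have r: "r + r' = 1 - u\<^sup>2" "r * r' = u\<^sup>2"
    unfolding r_def r'_def u by (simp_all add: power2_eq_square algebra_simps)
  have "(x\<^sup>2 - r) * (x\<^sup>2 - r') = x\<^sup>2 * (x\<^sup>2 + y\<^sup>2) - x\<^sup>2 * (r + r') - u\<^sup>2 + r * r'"
    unfolding u_def by algebra
  also have "\<dots> = 0" unfolding r sum by simp
  finally have "x\<^sup>2 = r \<or> x\<^sup>2 = r'" by auto
  moreover have "y < x"
    unfolding x_def y_def
  proof (rule sqrt_k_less)
    \<comment> \<open>As 81/100 is the square of 9/10, the comparison becomes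
      \<open>10/9 < 3/2 * 81/100\<close>.\<close>
    have t_gt: "81/100 < t" unfolding t_def by (rule real_less_rsqrt) (simp add: power2_eq_square)
    then have "9/10 < sqrt t" by (intro real_less_rsqrt) (simp add: power2_eq_square)
    then have "1 / sqrt t < 10/9" using t by (simp add: field_simps)
    moreover have "3 * (3 * t - t) \<le> pi * (3 * t - t)"
      using pi_gt3 t by (intro mult_right_mono) auto
    ultimately show "1 / sqrt t < pi * (3 * t - t) / 4" using t_gt by argo
  qed (use t in auto)
  then have "y\<^sup>2 < x\<^sup>2" using pos by (intro power_strict_mono) auto
  moreover have "r' < r"
    unfolding r_def r'_def by (intro mult_strict_left_mono) (auto intro: real_less_lsqrt)
  ultimately have "x\<^sup>2 = r \<and> y\<^sup>2 = r'" using sum r by auto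
  then show "(sqrt_k (sqrt (2/3)))\<^sup>2 = (2 - sqrt 3) * (sqrt 3 + sqrt 2)"
    and "(sqrt_k (sqrt 6))\<^sup>2 = (2 - sqrt 3) * (sqrt 3 - sqrt 2)"
    by (simp_all add: t3 x_def y_def r_def r'_def flip: t_def)
qed

text \<open>
  Eliminating \<open>a'\<close> and \<open>u'\<close> leaves a quartic in \<open>u\<close>, which splits over \<open>\<rat>(a)\<close> because
  \<open>a ^ 4 + 2 * a\<^sup>2 = 1\<close>; one quadratic factor has no real root.
\<close>

lemma cubic_solutions:
  fixes a a' u u' :: real
  assumes a: "a > 0" "a\<^sup>2 = sqrt 2 - 1" "a ^ 4 + a' ^ 4 = 1"
    and u: "u ^ 4 + u' ^ 4 = 1" and cubic: "a * u + a' * u' = 1"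
  shows "u = a ^ 3 * (2 - sqrt 3) \<or> u = a ^ 3 * (2 + sqrt 3)"
proof -
  have "(a\<^sup>2 + 1)\<^sup>2 = 2" using a by simp
  then have z: "a ^ 4 + 2 * a\<^sup>2 = 1"
    by (simp add: power2_eq_square power4_eq_xxxx algebra_simps)
  \<comment> \<open>Fourth powers of \<open>1 - a * u = a' * u'\<close> allow both complementary
    quantities to be eliminated.\<close>
  have "(1 - a * u) ^ 4 = a' ^ 4 * u' ^ 4"
    using cubic by (simp flip: power_mult_distrib cubic)
  also have "\<dots> = (1 - a ^ 4) * (1 - u ^ 4)"
    using a(3) u by algebra
  finally have *: "(1 - a * u) ^ 4 = (1 - a ^ 4) * (1 - u ^ 4)" .
  have "(u\<^sup>2 - 4 * a ^ 3 * u + a ^ 6) * (a\<^sup>2 * u\<^sup>2 + 1) = 0"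
    using * z by algebra
  moreover have "a\<^sup>2 * u\<^sup>2 + 1 > 0" by (simp add: add_nonneg_pos)
  ultimately have "u\<^sup>2 - 4 * a ^ 3 * u + a ^ 6 = 0" by auto
  moreover have "(sqrt 3)\<^sup>2 = (3::real)" by simp
  ultimately have "(u - a ^ 3 * (2 - sqrt 3)) * (u - a ^ 3 * (2 + sqrt 3)) = 0" by algebra
  then show ?thesis by auto
qed

text \<open>\<open>sqrt 2\<close> is a third of \<open>3 * sqrt 2\<close> and three times
  \<open>sqrt 2 / 3\<close>, so both unknowns solve the same equation with known \<open>a\<close>;
  monotonicity assigns the roots.\<close>

lemma sqrt_k_three_sqrt2:
  shows "(sqrt_k (sqrt 2 / 3))\<^sup>2 = (sqrt 2 - 1) ^ 3 * (7 + 4 * sqrt 3)"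
    and "(sqrt_k (3 * sqrt 2))\<^sup>2 = (sqrt 2 - 1) ^ 3 * (7 - 4 * sqrt 3)"
proof -
  define a where "a = sqrt_k (sqrt 2)"
  have a: "a > 0" "a\<^sup>2 = sqrt 2 - 1"
    by (simp_all add: a_def sqrt_k_pos sqrt_k_sqrt2)
  have q: "sqrt_k s ^ 4 + sqrt_k' s ^ 4 = 1" if "s > 0" for s using that by (rule sqrt_k_quartic)
  define u where "u = sqrt_k (3 * sqrt 2)"
  define v where "v = sqrt_k (sqrt 2 / 3)"
  have u: "u = a ^ 3 * (2 - sqrt 3) \<or> u = a ^ 3 * (2 + sqrt 3)"
    using sqrt_k_cubic[of "sqrt 2"] q a unfolding u_def a_def
    by (intro cubic_solutions[where a'="sqrt_k' (sqrt 2)" and u'="sqrt_k' (3 * sqrt 2)"]) auto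
  have v: "v = a ^ 3 * (2 - sqrt 3) \<or> v = a ^ 3 * (2 + sqrt 3)"
    using sqrt_k_cubic[of "sqrt 2 / 3"] q a unfolding v_def a_def
    by (intro cubic_solutions[where a'="sqrt_k' (sqrt 2)" and u'="sqrt_k' (sqrt 2 / 3)"]) (auto simp: mult.commute)
  have "u < v"
    unfolding u_def v_def
  proof (rule sqrt_k_less)
    \<comment> \<open>Replacing \<open>pi\<close> by 3 makes the right side
      \<open>2 * sqrt 2\<close>, which exceeds 2.\<close>
    have s2: "14/10 < sqrt (2::real)" by (rule real_less_rsqrt) (simp add: power2_eq_square)
    moreover have "1 / sqrt (sqrt 2 / 3) < 2"
    proof -
      have "1/2 < sqrt (sqrt 2 / 3)"
        using s2 by (intro real_less_rsqrt) (simp add: power2_eq_square)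
      then show ?thesis by (simp add: field_simps)
    qed
    moreover have "3 * (3 * sqrt 2 - sqrt 2 / 3) \<le> pi * (3 * sqrt 2 - sqrt 2 / 3)"
      using pi_gt3 s2 by (intro mult_right_mono) auto
    ultimately show "1 / sqrt (sqrt 2 / 3) < pi * (3 * sqrt 2 - sqrt 2 / 3) / 4" by argo
  qed auto
  moreover have "a ^ 3 * (2 - sqrt 3) < a ^ 3 * (2 + sqrt 3)"
    using a(1) by (intro mult_strict_left_mono) auto
  ultimately have uv: "u = a ^ 3 * (2 - sqrt 3)" "v = a ^ 3 * (2 + sqrt 3)" using u v by auto
  have a6: "(a ^ 3)\<^sup>2 = (sqrt 2 - 1) ^ 3" unfolding a(2)[symmetric] by algebra
  have "(2 - sqrt 3)\<^sup>2 = 7 - 4 * sqrt 3" "(2 + sqrt 3)\<^sup>2 = 7 + 4 * sqrt 3"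
    by (simp_all add: power2_eq_square algebra_simps)
  then show "(sqrt_k (sqrt 2 / 3))\<^sup>2 = (sqrt 2 - 1) ^ 3 * (7 + 4 * sqrt 3)"
    and "(sqrt_k (3 * sqrt 2))\<^sup>2 = (sqrt 2 - 1) ^ 3 * (7 - 4 * sqrt 3)"
    unfolding u_def[symmetric] v_def[symmetric] unfolding uv power_mult_distrib a6 by simp_all
qed

theorem theorem6p2:
  shows "h' 2 (1/4) = 2 powr (-1/4) * root 4 (sqrt 2 - 1) \<and>
         h' 2 (3/4) = 1/2 * root 4 ((16 - 8 * sqrt 3) * (sqrt 3 + sqrt 2)) \<and>
         h' 2 (1/12) = 1/2 * root 4 ((16 - 8 * sqrt 3) * (sqrt 3 - sqrt 2)) \<and>
         h' 2 (9/4) = 1/2 * root 4 ((sqrt 2 - 1) ^ 3 * (56 + 32 * sqrt 3)) \<and>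
         h' 2 (1/36) = 1/2 * root 4 ((sqrt 2 - 1) ^ 3 * (56 - 32 * sqrt 3))"
proof -
  have "root 4 (1/16 :: real) = 1/2"
    by (rule real_root_pos_unique) (simp_all add: power4_eq_xxxx)
  then have half: "1/2 * root 4 x = root 4 (x / 16)" for x
    by (metis real_root_mult mult.commute times_divide_eq_right mult_1_right)
  have "2 powr (-1/4) = root 4 (1/2 :: real)"
    by (simp add: root_powr_inverse powr_divide powr_minus_divide)
  then have quarter: "2 powr (-1/4) * root 4 x = root 4 (x / 2)" for x
    by (metis real_root_mult mult.commute times_divide_eq_right mult_1_right)
  \<comment> \<open>\<open>r\<close> is the reciprocal of \<open>sqrt (2 * n)\<close>, the argument
    at which the modulus is known.\<close>
  have h: "h' 2 n = root 4 y"
    if "n > 0" "sqrt (2 * n) = 1 / r" "(sqrt_k r)\<^sup>2 = x" "x / 2 = y" for n r x y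
    using h'_2_eq[OF that(1)] that(2-) by simp
  have h1: "h' 2 (1/4) = root 4 ((sqrt 2 - 1) / 2)"
    by (rule h[OF _ _ sqrt_k_sqrt2]) (auto simp: real_sqrt_divide)
  have h2: "h' 2 (3/4) = root 4 ((16 - 8 * sqrt 3) * (sqrt 3 + sqrt 2) / 16)"
    by (rule h[OF _ _ sqrt_k_two_thirds(1)]) (simp_all add: real_sqrt_divide field_simps)
  have h3: "h' 2 (1/12) = root 4 ((16 - 8 * sqrt 3) * (sqrt 3 - sqrt 2) / 16)"
    by (rule h[OF _ _ sqrt_k_two_thirds(2)]) (simp_all add: real_sqrt_divide field_simps)
  have h4: "h' 2 (9/4) = root 4 ((sqrt 2 - 1) ^ 3 * (56 + 32 * sqrt 3) / 16)"
  proof (rule h[OF _ _ sqrt_k_three_sqrt2(1)])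
    show "sqrt (2 * (9/4)) = 1 / (sqrt 2 / 3)"
      by (rule real_sqrt_unique) (simp_all add: power_divide)
  qed (simp_all add: field_simps)
  have h5: "h' 2 (1/36) = root 4 ((sqrt 2 - 1) ^ 3 * (56 - 32 * sqrt 3) / 16)"
  proof (rule h[OF _ _ sqrt_k_three_sqrt2(2)])
    show "sqrt (2 * (1/36)) = 1 / (3 * sqrt 2)"
      by (rule real_sqrt_unique) (simp_all add: power_divide power_mult_distrib)
  qed (simp_all add: field_simps)
  show ?thesis unfolding half quarter using h1 h2 h3 h4 h5 by blast
qed

end
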